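(* For every integer $n\ge 1$, the number of domino tilings of the generalized Aztec triangle with final partition $\mu=(n,n-1,\ldots,1)$ and parameter $\ell=2n$ is equal to the number of domino tilings of the generalized Aztec triangle with final partition $\mu=(n-1,n-2,\ldots,1,0)$ (regarded as a partition with $n$ parts) and parameter $\ell=2n+1$.
   Context: A domino is the union of two unit squares (with vertices in $\mathbb{Z}^2$) sharing an edge. A domino tiling of a finite union $D$ of such unit squares is a set of dominoes with pairwise disjoint interiors whose union is $D$. Generalized Aztec triangles. Let $\mu=(\mu_1\ge\mu_2\ge\cdots\ge\mu_n\ge 0)$ be a partition with $n$ (possibly zero) parts, and let $\ell\in\{2n,2n+1\}$. Put $P=\{\mu_j+n-j : 1\le j\le n\}\subseteq\{0,1,\ldots,\mu_1+n-1\}$ (the positions of the "particles" of $\mu$; the other elements of $\{0,\ldots,\mu_1+n-1\}$ are the "holes"). For integers $c,d\ge 0$ let $Q(c,d)$ be the unit square $[c,c+1]\times[c-d,c-d+1]$; it lies on "diagonal $d$", where diagonals run from southwest to northeast and the first square of diagonal $d+1$ lies directly below the first square of diagonal $d$. - If $\ell=2n$ (type 1), the generalized Aztec triangle with final partition $\mu$ and parameter $\ell$ is the union of all squares $Q(c,d)$ with $0\le d\le 2n-2$ and $0\le c<\mu_1+\lceil d/2\rceil$, together with the squares $Q(c,2n-1)$ for $c\in\{0,\ldots,\mu_1+n-1\}\setminus P$. - If $\ell=2n+1$ (type 2), it is the union of all squares $Q(c,d)$ with $0\le d\le 2n-1$ and $0\le c<\mu_1+\lceil d/2\rceil$, together with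 the squares $Q(c,2n)$ for $c\in P$. *)

theory Defs
  imports "HOL-Analysis.Analysis"
begin

definition unit_square :: "int \<Rightarrow> int \<Rightarrow> (real \<times> real) set" where
  "unit_square a b = {of_int a .. of_int a + 1} \<times> {of_int b .. of_int b + 1}"

definition is_domino :: "(real \<times> real) set \<Rightarrow> bool" where
  "is_domino A \<longleftrightarrow>
     (\<exists>a b. A = unit_square a b \<union> unit_square (a + 1) b \<or>
            A = unit_square a b \<union> unit_square a (b + 1))"

definition domino_tiling :: "(real \<times> real) set \<Rightarrow> (real \<times> real) set set \<Rightarrow> bool" where
  "domino_tiling D T \<longleftrightarrow>
     (\<forall>A\<in>T. is_domino A) \<and>
     pairwise (\<lambda>A B. disjnt (interior A) (interior B)) T \<and>
     \<Union>T = D"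

text \<open>A bounded region contains only finitely many dominoes, so for such regions the set below
  is finite and \<^const>\<open>card\<close> is the genuine number of tilings.\<close>

definition num_domino_tilings :: "(real \<times> real) set \<Rightarrow> nat" where
  "num_domino_tilings D = card {T. domino_tiling D T}"

definition diag_square :: "nat \<Rightarrow> nat \<Rightarrow> (real \<times> real) set" where
  "diag_square c d = unit_square (int c) (int c - int d)"

text \<open>A partition with \<open>n\<close> (possibly zero) parts is a weakly decreasing list of length \<open>n\<close>.
  List indices start at 0, so the part \<open>\<mu>\<^sub>j\<close> is \<open>\<mu> ! (j - 1)\<close>.\<close>

definition first_part :: "nat list \<Rightarrow> nat" where
  "first_part \<mu> = (case \<mu> of [] \<Rightarrow> 0 | m # _ \<Rightarrow> m)"

definition particles :: "nat list \<Rightarrow> nat set" where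
  "particles \<mu> = {\<mu> ! (j - 1) + (length \<mu> - j) | j. 1 \<le> j \<and> j \<le> length \<mu>}"

definition holes :: "nat list \<Rightarrow> nat set" where
  "holes \<mu> = {0 ..< first_part \<mu> + length \<mu>} - particles \<mu>"

text \<open>Since \<open>d\<close> is a natural number, \<open>(d + 1) div 2\<close> is the ceiling of \<open>d/2\<close>. The bounds on \<open>d\<close>
  are \<open>d \<le> 2n - 2\<close> and \<open>d \<le> 2n - 1\<close>, written without truncated subtraction. The parameter \<open>l\<close> is
  meant to be \<open>2n\<close> or \<open>2n + 1\<close>; the region is empty for all other values.\<close>

definition aztec_triangle :: "nat list \<Rightarrow> nat \<Rightarrow> (real \<times> real) set" where
  "aztec_triangle \<mu> l =
    (let n = length \<mu> in
     if l = 2 * n then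
       \<Union>{diag_square c d | c d. d + 2 \<le> 2 * n \<and> c < first_part \<mu> + (d + 1) div 2} \<union>
       \<Union>{diag_square c (2 * n - 1) | c. c \<in> holes \<mu>}
     else if l = 2 * n + 1 then
       \<Union>{diag_square c d | c d. d + 1 \<le> 2 * n \<and> c < first_part \<mu> + (d + 1) div 2} \<union>
       \<Union>{diag_square c (2 * n) | c. c \<in> particles \<mu>}
     else {})"

end

theory Submission
  imports Defs "Jordan_Normal_Form.Determinant"
begin

text \<open>
  Cut the triangle along its diagonals. A domino always joins two consecutive diagonals, and a
  square \<open>c\<close> of diagonal \<open>d\<close> can be joined to the squares \<open>c\<close> and \<open>c + 1\<close> of diagonal
  \<open>d + 1\<close> only. A tiling is therefore a perfect matching, and it is determined by what happens
  between consecutive diagonals. On an even diagonal \<open>2k\<close> call the squares that are joined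
  backwards the particles, on an odd diagonal \<open>2k + 1\<close> the squares that are joined forwards;
  there are \<open>k\<close> and \<open>k + 1\<close> of them. From an odd to an even diagonal every particle stays or
  moves by one (a vertical strip is added to the corresponding partition); from an even to an odd
  diagonal the old particles interlace with the new ones (a horizontal strip is added, and one more
  particle is born).

  The number of tilings of the first few diagonals, as a function of the final particle positions
  \<open>p\<^sub>1 < \<dots> < p\<^sub>k\<close>, is a \<open>k \<times> k\<close> determinant whose entry \<open>(i, j)\<close> is the coefficient of
  \<open>z\<close> to the power \<open>p\<^sub>i\<close> in a power series \<open>F\<^sub>j\<close>. This class of functions is preserved by both
  kinds of steps: a vertical strip multiplies every \<open>F\<^sub>j\<close> by \<open>1 + z\<close>
  (\<open>vertical_strip_step\<close>), and a horizontal strip multiplies every \<open>F\<^sub>j\<close> by \<open>- z / (1 - z)\<close>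
  and adds a new series \<open>1 / (1 - z)\<close> (\<open>horizontal_strip_step\<close>). With
  \<open>w = - z (1 + z) / (1 - z)\<close>, the series on an odd diagonal are thus \<open>w\<^sup>e / (1 - z)\<close> and on an
  even one \<open>w\<^sup>e (1 + z) / (1 - z)\<close>, where \<open>e\<close> runs through \<open>0, \<dots>, n - 1\<close>. The first
  triangle has \<open>n\<close> particles at \<open>1, 3, \<dots>, 2n - 1\<close>, on an odd diagonal; the second one has them at
  \<open>0, 2, \<dots>, 2n - 2\<close>, on an even diagonal. The determinants depend on the particle positions alone, which
  is why two triangles of different widths can be compared.

  It remains to compare two determinants: one formed by the odd parts of the series
  \<open>w\<^sup>e / (1 - z)\<close>, the other by the even parts of \<open>w\<^sup>e (1 + z) / (1 - z)\<close>. Put \<open>t = z\<^sup>2\<close>. Since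
  \<open>w(z) w(-z) = - t\<close> and \<open>w(z) + w(-z) = - 4 t / (1 - t)\<close> are series in \<open>t\<close>, the powers of \<open>w\<close>
  satisfy a recurrence of order two with coefficients in \<open>t\<close>, and so do the odd and even parts.
  Let \<open>U\<^sub>e\<close> be the solution with \<open>U\<^sub>0 = 1\<close> and \<open>U\<^sub>-\<^sub>1 = 0\<close>. Comparing initial values, the even
  parts are \<open>(1 + t) / (1 - t) U\<^sub>e\<close> (\<open>even_part_step_series\<close>) and the odd parts are
  \<open>(U\<^sub>e - U\<^sub>e\<^sub>-\<^sub>1) / (1 - t)\<close> (\<open>odd_part_step_series\<close>). Multiplying all series by one with
  constant term 1 is a unitriangular row operation, and subtracting \<open>U\<^sub>e\<^sub>-\<^sub>1\<close> from \<open>U\<^sub>e\<close> is a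
  unitriangular column operation, so both determinants are equal to the one formed by the \<open>U\<^sub>e\<close>
  (\<open>even_minor_eq_odd_minor\<close>).
\<close>

section \<open>Domino tilings as perfect matchings\<close>

text \<open>The pair \<open>(c, d)\<close> stands for the square \<open>diag_square c d\<close>. In these coordinates
  \<open>e = 0\<close> gives the vertical dominoes and \<open>e = 1\<close> the horizontal ones.\<close>

definition dominoes :: "(nat \<times> nat) set set" where
  "dominoes = {{(c, d), (c + e, Suc d)} | c d e. e \<le> 1}"

definition matchings :: "(nat \<times> nat) set \<Rightarrow> (nat \<times> nat) set set set" where
  "matchings C = {M. M \<subseteq> dominoes \<and> disjoint M \<and> \<Union>M = C}"

definition region :: "(nat \<times> nat) set \<Rightarrow> (real \<times> real) set" where
  "region C = (\<Union>(c, d)\<in>C. diag_square c d)"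

text \<open>Points without integer coordinates lie on no edge, so they lie in exactly one unit square. They
  detect which cells a region contains and, being dense, whether two interiors meet.\<close>

lemma generic_point_in_unit_square:
  assumes "x \<notin> \<int>" "y \<notin> \<int>"
  shows "(x, y) \<in> unit_square a b \<longleftrightarrow> a = \<lfloor>x\<rfloor> \<and> b = \<lfloor>y\<rfloor>"
proof -
  have "x \<noteq> of_int a + 1" "y \<noteq> of_int b + 1"
    using assms by (metis Ints_1 Ints_add Ints_of_int)+
  then show ?thesis
    unfolding unit_square_def by (auto simp: eq_commute[of _ "\<lfloor>_\<rfloor>"] floor_eq_iff)
qed

lemma generic_point_in_region:
  assumes "x \<notin> \<int>" "y \<notin> \<int>"
  shows "(x, y) \<in> region C \<longleftrightarrow> (\<exists>(c, d)\<in>C. int c = \<lfloor>x\<rfloor> \<and> int c - int d = \<lfloor>y\<rfloor>)"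
  unfolding region_def diag_square_def using generic_point_in_unit_square[OF assms] by auto

lemma half_not_int: "of_int a + 1 / 2 \<notin> (\<int> :: real set)"
proof
  assume "of_int a + 1 / 2 \<in> (\<int> :: real set)"
  then obtain b :: int where "of_int a + 1 / 2 = (of_int b :: real)" by (auto elim: Ints_cases)
  then have "of_int (2 * a + 1) = (of_int (2 * b) :: real)" by (simp add: field_simps)
  then have "2 * a + 1 = 2 * b" by (simp only: of_int_eq_iff)
  then show False by presburger
qed

lemma centre_in_region:
  "(of_int a + 1 / 2, of_int b + 1 / 2) \<in> region C \<longleftrightarrow> (\<exists>(c, d)\<in>C. int c = a \<and> int c - int d = b)"
proof -
  have "\<lfloor>of_int i + 1 / 2 :: real\<rfloor> = i" for i by (rule floor_unique) auto
  then show ?thesis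
    unfolding generic_point_in_region[OF half_not_int half_not_int] by (simp only:)
qed

lemma region_subset_iff: "region C \<subseteq> region C' \<longleftrightarrow> C \<subseteq> C'"
proof
  assume sub: "region C \<subseteq> region C'"
  show "C \<subseteq> C'"
  proof (intro subsetI, clarify)
    fix c d assume "(c, d) \<in> C"
    then have "(of_int (int c) + 1 / 2, of_int (int c - int d) + 1 / 2) \<in> region C"
      unfolding centre_in_region by blast
    then have "(of_int (int c) + 1 / 2, of_int (int c - int d) + 1 / 2) \<in> region C'"
      using sub by blast
    then show "(c, d) \<in> C'" unfolding centre_in_region by auto
  qed
next
  show "C \<subseteq> C' \<Longrightarrow> region C \<subseteq> region C'" unfolding region_def by (rule UN_mono) auto
qed

lemma region_eq_iff: "region C = region C' \<longleftrightarrow> C = C'"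
  unfolding set_eq_subset region_subset_iff ..

lemma region_Union: "region (\<Union>M) = \<Union>(region ` M)"
  by (auto simp: region_def)

lemma generic_point_in_open:
  fixes S :: "(real \<times> real) set"
  assumes "open S" "S \<noteq> {}"
  shows "\<exists>x y. (x, y) \<in> S \<and> x \<notin> \<int> \<and> y \<notin> \<int>"
proof -
  obtain x0 y0 where "(x0, y0) \<in> S" using assms(2) by auto
  then obtain A B where AB: "open A" "open B" "x0 \<in> A" "y0 \<in> B" "A \<times> B \<subseteq> S"
    using assms(1) by (rule_tac open_prod_elim[of S "(x0, y0)"]) auto
  have "\<exists>x\<in>A. x \<notin> \<int>" if "open A" "x0 \<in> A" for A and x0 :: real
  proof -
    have "countable (\<int> :: real set)" by (simp add: Ints_def)
    with that show ?thesis using open_minus_countable[of "\<int>" A] by blast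
  qed
  from this[OF AB(1,3)] this[OF AB(2,4)]
  obtain x y where "x \<in> A" "x \<notin> \<int>" "y \<in> B" "y \<notin> \<int>" by (elim bexE)
  moreover from this have "(x, y) \<in> S" using AB(5) by (intro subsetD[OF AB(5)] SigmaI)
  ultimately show ?thesis by (intro exI conjI)
qed

lemma disjnt_interior_region_iff:
  "disjnt (interior (region C)) (interior (region C')) \<longleftrightarrow> disjnt C C'"
proof
  assume disj: "disjnt (interior (region C)) (interior (region C'))"
  show "disjnt C C'"
  proof (rule ccontr)
    assume "\<not> disjnt C C'"
    then obtain c d where cd: "(c, d) \<in> C" "(c, d) \<in> C'" by (auto simp: disjnt_iff)
    let ?z = "(of_int (int c) + 1 / 2, of_int (int c - int d) + 1 / 2) :: real \<times> real"
    let ?B = "{of_int (int c) <..< of_int (int c) + 1} \<times>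
        {of_int (int c - int d) <..< of_int (int c - int d) + 1} :: (real \<times> real) set"
    have "open ?B" "?B \<subseteq> diag_square c d" "?z \<in> ?B"
      by (auto simp: diag_square_def unit_square_def intro: open_Times)
    moreover have "diag_square c d \<subseteq> region C" "diag_square c d \<subseteq> region C'"
      using cd by (auto simp: region_def)
    ultimately have "?z \<in> interior (region C)" "?z \<in> interior (region C')"
      by (meson interiorI subset_trans)+
    then show False using disj by (auto simp: disjnt_iff)
  qed
next
  assume empty: "disjnt C C'"
  show "disjnt (interior (region C)) (interior (region C'))"
  proof (rule ccontr)
    assume "\<not> disjnt (interior (region C)) (interior (region C'))"
    then obtain x y where xy: "(x, y) \<in> interior (region C) \<inter> interior (region C')" "x \<notin> \<int>" "y \<notin> \<int>"
      using generic_point_in_open[of "interior (region C) \<inter> interior (region C')"]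
      by (auto simp: disjnt_def)
    then have "(x, y) \<in> region C" "(x, y) \<in> region C'" using interior_subset by blast+
    then obtain c d c' d' where cd: "(c, d) \<in> C" "(c', d') \<in> C'"
      "int c = \<lfloor>x\<rfloor>" "int c - int d = \<lfloor>y\<rfloor>" "int c' = \<lfloor>x\<rfloor>" "int c' - int d' = \<lfloor>y\<rfloor>"
      using xy(2,3) by (auto simp: generic_point_in_region)
    then have "c = c'" "d = d'" by linarith+
    then show False using cd(1,2) empty unfolding disjnt_iff by simp
  qed
qed

lemma region_pair: "region {(c, d), (c', d')} =
    unit_square (int c) (int c - int d) \<union> unit_square (int c') (int c' - int d')"
  by (simp add: region_def diag_square_def)

lemma is_domino_region: "A \<in> dominoes \<Longrightarrow> is_domino (region A)"
proof -
  assume "A \<in> dominoes"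
  then obtain c d e where e: "e \<le> 1" and A: "A = {(c, d), (c + e, Suc d)}" by (auto simp: dominoes_def)
  consider "e = 0" | "e = 1" using e by linarith
  then show "is_domino (region A)"
  proof cases
    case 1
    have "int c - int d = int c - int (Suc d) + 1" by simp
    with 1 have "region A = unit_square (int c) (int c - int (Suc d)) \<union>
        unit_square (int c) (int c - int (Suc d) + 1)"
      unfolding A region_pair by (simp only: add_0_right Un_commute)
    then show ?thesis unfolding is_domino_def by blast
  next
    case 2
    have "int (c + 1) = int c + 1" "int (c + 1) - int (Suc d) = int c - int d" by simp_all
    with 2 have "region A = unit_square (int c) (int c - int d) \<union>
        unit_square (int c + 1) (int c - int d)"
      unfolding A region_pair by (simp only:)
    then show ?thesis unfolding is_domino_def by blast
  qed
qed

lemma unit_square_subset_region: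
  assumes "unit_square a b \<subseteq> region C"
  obtains c d where "(c, d) \<in> C" "a = int c" "b = int c - int d"
proof -
  have "(of_int a + 1 / 2, of_int b + 1 / 2) \<in> unit_square a b" by (auto simp: unit_square_def)
  then have "(of_int a + 1 / 2, of_int b + 1 / 2) \<in> region C" using assms by blast
  then show ?thesis using that unfolding centre_in_region by auto
qed

lemma domino_in_region:
  assumes "is_domino A" "A \<subseteq> region C"
  shows "A \<in> region ` dominoes"
proof -
  obtain a b where "A = unit_square a b \<union> unit_square (a + 1) b \<or>
      A = unit_square a b \<union> unit_square a (b + 1)"
    using assms(1) unfolding is_domino_def by blast
  then show ?thesis
  proof
    assume A: "A = unit_square a b \<union> unit_square (a + 1) b"
    then obtain c d where cd: "a = int c" "b = int c - int d"
      using assms(2) unit_square_subset_region[of a b C] by blast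
    have "int (c + 1) = a + 1" "int (c + 1) - int (Suc d) = b" using cd by simp_all
    then have "A = region {(c, d), (c + 1, Suc d)}"
      unfolding A region_pair cd by (simp only:)
    then show ?thesis unfolding dominoes_def by blast
  next
    assume A: "A = unit_square a b \<union> unit_square a (b + 1)"
    then obtain c d where cd: "a = int c" "b + 1 = int c - int d"
      using assms(2) unit_square_subset_region[of a "b + 1" C] by blast
    have "int c - int (Suc d) = b" using cd by simp
    then have "A = region {(c, d), (c + 0, Suc d)}"
      unfolding A region_pair cd by (simp add: cd Un_commute)
    then show ?thesis unfolding dominoes_def by blast
  qed
qed

text \<open>The map \<open>region\<close> from sets of cells to subsets of the plane is injective, commutes with unions,
  and turns disjoint sets of cells into sets with disjoint interiors, so it carries perfect matchings
  to tilings. A domino that lies in a region is made of two cells of that region, hence every tiling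
  is obtained.\<close>

lemma num_domino_tilings_region: "num_domino_tilings (region C) = card (matchings C)"
proof -
  have inj: "inj region" by (rule injI) (simp add: region_eq_iff)
  have iff: "domino_tiling (region C) (region ` M) \<longleftrightarrow> M \<in> matchings C" if "M \<subseteq> dominoes" for M
  proof -
    have "pairwise (\<lambda>A B. disjnt (interior A) (interior B)) (region ` M) \<longleftrightarrow> disjoint M"
      by (simp add: pairwise_def region_eq_iff disjnt_interior_region_iff)
    moreover have "\<Union>(region ` M) = region C \<longleftrightarrow> \<Union>M = C"
      unfolding region_Union[symmetric] region_eq_iff ..
    moreover have "\<forall>A\<in>region ` M. is_domino A" using that is_domino_region by auto
    ultimately show ?thesis
      using that unfolding domino_tiling_def matchings_def mem_Collect_eq by argo
  qed
  have "{T. domino_tiling (region C) T} = (`) region ` matchings C"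
  proof (intro subset_antisym subsetI)
    fix T assume "T \<in> {T. domino_tiling (region C) T}"
    then have T: "domino_tiling (region C) T" by simp
    have "T \<subseteq> region ` dominoes"
    proof
      fix A assume "A \<in> T"
      then show "A \<in> region ` dominoes"
        using T by (intro domino_in_region[of _ C]) (auto simp: domino_tiling_def)
    qed
    then obtain M where M: "M \<subseteq> dominoes" "T = region ` M" by (auto simp: subset_image_iff)
    then have "M \<in> matchings C" using T iff[OF M(1)] by simp
    then show "T \<in> (`) region ` matchings C" using M(2) by (intro image_eqI)
  next
    fix T assume "T \<in> (`) region ` matchings C"
    then obtain M where "M \<in> matchings C" "T = region ` M" by auto
    then show "T \<in> {T. domino_tiling (region C) T}" using iff[of M] by (simp add: matchings_def)
  qed
  moreover have "inj_on ((`) region) (matchings C)"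
    by (rule inj_onI) (simp add: inj_image_eq_iff[OF inj])
  ultimately show ?thesis unfolding num_domino_tilings_def by (simp add: card_image)
qed

section \<open>Matching the last diagonal cell by cell\<close>

lemma finite_matchings: "finite C \<Longrightarrow> finite (matchings C)"
  by (rule finite_subset[of _ "Pow (Pow C)"]) (auto simp: matchings_def)

text \<open>Classify the matchings by the partner \<open>y\<close> of the cell \<open>x\<close>.\<close>

lemma matchings_cover_cell:
  assumes fin: "finite C" and x: "x \<in> C"
  shows "card (matchings C) = (\<Sum>y | y \<in> C \<and> {x, y} \<in> dominoes. card (matchings (C - {x, y})))"
proof -
  let ?Y = "{y. y \<in> C \<and> {x, y} \<in> dominoes}"
  let ?S = "\<lambda>y. insert {x, y} ` matchings (C - {x, y})"
  have eq: "matchings C = (\<Union>y\<in>?Y. ?S y)"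
  proof (intro subset_antisym subsetI)
    fix M assume M: "M \<in> matchings C"
    then obtain A where A: "A \<in> M" "x \<in> A" using x by (auto simp: matchings_def)
    then have "A \<in> dominoes" using M by (auto simp: matchings_def)
    then obtain y where y: "A = {x, y}"
      using A(2) by (fastforce simp: dominoes_def)
    have "\<Union>(M - {A}) = C - A"
      using M A(1) by (fastforce simp: matchings_def disjoint_def pairwise_def disjnt_def)
    then have "M - {A} \<in> matchings (C - {x, y})"
      using M y by (auto simp: matchings_def pairwise_def)
    moreover have "M = insert {x, y} (M - {A})" using A y by auto
    moreover have "y \<in> ?Y" using A y M \<open>A \<in> dominoes\<close> by (auto simp: matchings_def)
    ultimately show "M \<in> (\<Union>y\<in>?Y. ?S y)" by blast
  next
    fix M assume "M \<in> (\<Union>y\<in>?Y. ?S y)"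
    then obtain y N where y: "y \<in> C" "{x, y} \<in> dominoes" and N: "N \<in> matchings (C - {x, y})"
      and M: "M = insert {x, y} N" by auto
    have "B \<subseteq> C - {x, y}" if "B \<in> N" for B using that N by (auto simp: matchings_def)
    then show "M \<in> matchings C"
      using N y x unfolding matchings_def M
      by (fastforce simp: disjoint_def pairwise_insert disjnt_def)
  qed
  have inj: "inj_on (insert {x, y}) (matchings (C - {x, y}))" for y
  proof (rule inj_onI)
    fix N N' assume "N \<in> matchings (C - {x, y})" "N' \<in> matchings (C - {x, y})"
    then have "{x, y} \<notin> N" "{x, y} \<notin> N'" by (auto simp: matchings_def)
    then show "insert {x, y} N = insert {x, y} N' \<Longrightarrow> N = N'" by (simp add: insert_ident)
  qed
  have partner: "y' = y" if "Z \<in> ?S y" "{x, y'} \<in> Z" for Z y y'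
  proof -
    obtain N where "N \<in> matchings (C - {x, y})" "Z = insert {x, y} N" using \<open>Z \<in> ?S y\<close> by auto
    then have "x \<notin> \<Union>N" "{x, y'} \<in> insert {x, y} N"
      using that(2) by (auto simp: matchings_def)
    then have "{x, y'} = {x, y}" by auto
    then show ?thesis by (auto simp: doubleton_eq_iff)
  qed
  have disj: "?S y \<inter> ?S y' = {}" if "y \<noteq> y'" for y y'
  proof (rule ccontr)
    assume "?S y \<inter> ?S y' \<noteq> {}"
    then obtain Z where Z: "Z \<in> ?S y" "Z \<in> ?S y'" by blast
    from Z(2) have "{x, y'} \<in> Z" by blast
    then show False using partner[OF Z(1)] that by blast
  qed
  have "card (matchings C) = (\<Sum>y\<in>?Y. card (?S y))"
    unfolding eq using fin disj by (intro card_UN_disjoint) (auto simp: finite_matchings)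
  then show ?thesis using inj by (simp add: card_image)
qed

lemma matchings_empty: "card (matchings {}) = 1"
proof -
  have "matchings {} = {{}}"
    by (auto simp: matchings_def dominoes_def)
  then show ?thesis by simp
qed

text \<open>In the triangles of both types every odd diagonal is one cell wider than its predecessor.\<close>

definition staircase :: "nat \<Rightarrow> nat \<Rightarrow> (nat \<times> nat) set" where
  "staircase m D = {(c, d). d < D \<and> c < m + (d + 1) div 2}"

text \<open>Diagonal \<open>D\<close> consists of \<open>U\<close> and diagonal \<open>D + 1\<close> of \<open>T\<close>. Such shapes
  arise when the cells of diagonal \<open>D + 1\<close> are matched one at a time.\<close>

definition two_layers :: "nat \<Rightarrow> nat \<Rightarrow> nat set \<Rightarrow> nat set \<Rightarrow> nat" where
  "two_layers m D U T = card (matchings (staircase m D \<union> U \<times> {D} \<union> T \<times> {Suc D}))"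

lemma finite_staircase: "finite (staircase m D)"
  by (rule finite_subset[of _ "{..<m + D} \<times> {..<D}"]) (auto simp: staircase_def)

lemma two_layers_cover:
  assumes "finite U" "finite T" "t \<in> T"
  shows "two_layers m D U T = (if t \<in> U then two_layers m D (U - {t}) (T - {t}) else 0) +
      (if t \<ge> 1 \<and> t - 1 \<in> U then two_layers m D (U - {t - 1}) (T - {t}) else 0)"
proof -
  let ?C = "staircase m D \<union> U \<times> {D} \<union> T \<times> {Suc D}"
  let ?Y = "{y. y \<in> ?C \<and> {(t, Suc D), y} \<in> dominoes}"
  let ?Y1 = "if t \<in> U then {(t, D)} else {}"
  let ?Y2 = "if t \<ge> 1 \<and> t - 1 \<in> U then {(t - 1, D)} else {}"
  have "?Y = ?Y1 \<union> ?Y2"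
  proof (intro subset_antisym subsetI)
    fix y assume y: "y \<in> ?Y"
    then obtain c d e where e: "e \<le> 1" "{(t, Suc D), y} = {(c, d), (c + e, Suc d)}"
      by (auto simp: dominoes_def)
    have "d \<noteq> Suc D" using e y by (auto simp: doubleton_eq_iff staircase_def)
    then have "y = (c, D)" "c + e = t" using e by (auto simp: doubleton_eq_iff)
    then show "y \<in> ?Y1 \<union> ?Y2" using y e(1) by (cases e) (auto simp: staircase_def)
  next
    fix y assume y: "y \<in> ?Y1 \<union> ?Y2"
    then obtain e where e: "e \<le> 1" "e \<le> t" "y = (t - e, D)" "t - e \<in> U"
      by (auto split: if_splits intro: that[of 0] that[of 1])
    then have "{(t, Suc D), y} = {(t - e, D), (t - e + e, Suc D)}" by auto
    then have "{(t, Suc D), y} \<in> dominoes" unfolding dominoes_def using e(1) by blast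
    then show "y \<in> ?Y" using e by auto
  qed
  moreover have "?C - {(t, Suc D), (u, D)} =
      staircase m D \<union> (U - {u}) \<times> {D} \<union> (T - {t}) \<times> {Suc D}" for u
    by (auto simp: staircase_def)
  moreover have "finite ?C" using assms finite_staircase by auto
  then have "two_layers m D U T = (\<Sum>y\<in>?Y. card (matchings (?C - {(t, Suc D), y})))"
    unfolding two_layers_def using assms(3) by (intro matchings_cover_cell) auto
  ultimately show ?thesis
    by (auto simp: two_layers_def)
qed

lemma two_layers_full:
  "two_layers m D {..<m + (D + 1) div 2} T = two_layers m (Suc D) T {}"
proof -
  have "staircase m D \<union> {..<m + (D + 1) div 2} \<times> {D} = staircase m (Suc D)"
    by (auto simp: staircase_def less_Suc_eq)
  then show ?thesis by (simp add: two_layers_def)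
qed

section \<open>Determinants given by lists of rows\<close>

text \<open>Rows are infinite sequences, cut off to make the matrix square. Keeping the rows in a list makes
  it easy to replace a row in the middle, which is what all arguments below do.\<close>

definition list_det :: "(nat \<Rightarrow> real) list \<Rightarrow> real" where
  "list_det rs = Determinant.det (Matrix.mat (length rs) (length rs) (\<lambda>(i, j). (rs ! i) j))"

lemma list_det_cong:
  assumes "length rs = length rs'"
    and "\<And>i j. i < length rs \<Longrightarrow> j < length rs \<Longrightarrow> (rs ! i) j = (rs' ! i) j"
  shows "list_det rs = list_det rs'"
proof -
  have "Matrix.mat (length rs) (length rs) (\<lambda>(i, j). (rs ! i) j) =
      Matrix.mat (length rs') (length rs') (\<lambda>(i, j). (rs' ! i) j)"
    using assms by (intro eq_matI) auto
  then show ?thesis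
    unfolding list_det_def by simp
qed

text \<open>Laplace expansion: the cofactors along a row do not depend on the entries of that row.\<close>

lemma list_det_expand_row:
  "\<exists>c. \<forall>u. list_det (xs @ u # ys) = (\<Sum>j<length xs + Suc (length ys). u j * c j)"
proof -
  let ?n = "length xs + Suc (length ys)"
  let ?A = "\<lambda>u. Matrix.mat ?n ?n (\<lambda>(i, j). ((xs @ u # ys) ! i) j)"
  have cof: "cofactor (?A u) (length xs) j = cofactor (?A (\<lambda>_. 0)) (length xs) j"
    if "j < ?n" for u j
  proof -
    have "mat_delete (?A u) (length xs) j = mat_delete (?A (\<lambda>_. 0)) (length xs) j"
      unfolding mat_delete_def using that by (intro eq_matI) (auto simp: nth_append nth_Cons')
    then show ?thesis
      by (simp add: cofactor_def)
  qed
  have "list_det (xs @ u # ys) =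
      (\<Sum>j<?n. u j * cofactor (?A (\<lambda>_. 0)) (length xs) j)" for u
  proof -
    have "list_det (xs @ u # ys) = Determinant.det (?A u)"
      by (simp add: list_det_def)
    also have "\<dots> = (\<Sum>j<?n. ?A u $$ (length xs, j) * cofactor (?A u) (length xs) j)"
      by (rule laplace_expansion_row) auto
    also have "\<dots> = (\<Sum>j<?n. u j * cofactor (?A (\<lambda>_. 0)) (length xs) j)"
    proof (rule sum.cong[OF refl])
      fix j assume "j \<in> {..<?n}"
      then show "?A u $$ (length xs, j) * cofactor (?A u) (length xs) j =
          u j * cofactor (?A (\<lambda>_. 0)) (length xs) j"
        using cof[of j u] by simp
    qed
    finally show ?thesis .
  qed
  then show ?thesis by blast
qed

lemma list_det_add_row:
  assumes "\<And>j. u j = v j + w j"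
  shows "list_det (xs @ u # ys) = list_det (xs @ v # ys) + list_det (xs @ w # ys)"
proof -
  obtain c where c: "\<And>u. list_det (xs @ u # ys) = (\<Sum>j<length xs + Suc (length ys). u j * c j)"
    using list_det_expand_row[of xs ys] by blast
  show ?thesis
    unfolding c by (simp add: assms distrib_right sum.distrib)
qed

lemma list_det_repeated_row: "list_det (xs @ u # ys @ u # zs) = 0"
proof -
  let ?rs = "xs @ u # ys @ u # zs" and ?i = "length xs" and ?j = "length xs + Suc (length ys)"
  let ?n = "length ?rs"
  show ?thesis
    unfolding list_det_def
  proof (rule Determinant.det_identical_rows[where n = ?n and i = ?i and j = ?j])
    show "Matrix.row (Matrix.mat ?n ?n (\<lambda>(i, j). (?rs ! i) j)) ?i =
        Matrix.row (Matrix.mat ?n ?n (\<lambda>(i, j). (?rs ! i) j)) ?j"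
      by (intro eq_vecI) (auto simp: nth_append)
  qed auto
qed

lemma list_det_zero_column:
  assumes "\<And>u. u \<in> set rs \<Longrightarrow> u j = 0" "j < length rs"
  shows "list_det rs = 0"
proof -
  let ?A = "Matrix.mat (length rs) (length rs) (\<lambda>(i, j). (rs ! i) j)"
  have "Determinant.det ?A = (\<Sum>i<length rs. ?A $$ (i, j) * cofactor ?A i j)"
    by (rule laplace_expansion_column) (use assms in auto)
  also have "\<dots> = 0"
    using assms by (intro sum.neutral) auto
  finally show ?thesis by (simp add: list_det_def)
qed

lemma list_det_unit_corner:
  assumes "\<And>v. v \<in> set rs \<Longrightarrow> v (length rs) = 0" "u (length rs) = 1"
  shows "list_det (rs @ [u]) = list_det rs"
proof -
  let ?k = "length rs"
  let ?A = "Matrix.mat (Suc ?k) (Suc ?k) (\<lambda>(i, j). ((rs @ [u]) ! i) j)"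
  have "Determinant.det ?A = (\<Sum>i<Suc ?k. ?A $$ (i, ?k) * cofactor ?A i ?k)"
    by (rule laplace_expansion_column) auto
  also have "\<dots> = cofactor ?A ?k ?k"
    using assms by (auto simp: nth_append intro!: sum.neutral)
  also have "\<dots> = Determinant.det (mat_delete ?A ?k ?k)"
    by (simp add: cofactor_def)
  also have "mat_delete ?A ?k ?k = Matrix.mat ?k ?k (\<lambda>(i, j). (rs ! i) j)"
    unfolding mat_delete_def by (intro eq_matI) (auto simp: nth_append)
  finally show ?thesis by (simp add: list_det_def)
qed

section \<open>Transfer between consecutive diagonals\<close>

abbreviation geometric :: "real fps" where
  "geometric \<equiv> inverse (1 - fps_X)"

text \<open>Row \<open>p\<close> of the infinite matrix whose columns are the coefficient sequences of the \<open>F\<^sub>j\<close>; the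
  minors below choose the rows \<open>ps\<close> and the first \<open>length ps\<close> columns.\<close>

definition coeff_row :: "(nat \<Rightarrow> real fps) \<Rightarrow> nat \<Rightarrow> nat \<Rightarrow> real" where
  "coeff_row F p j = fps_nth (F j) p"

definition coeff_minor :: "(nat \<Rightarrow> real fps) \<Rightarrow> nat list \<Rightarrow> real" where
  "coeff_minor F ps = list_det (map (coeff_row F) ps)"

lemma coeff_minor_cong:
  assumes "\<And>j. j < length ps \<Longrightarrow> F j = G j"
  shows "coeff_minor F ps = coeff_minor G ps"
  unfolding coeff_minor_def using assms by (intro list_det_cong) (auto simp: coeff_row_def)

text \<open>The only property of \<open>two_layers\<close> that the transfer between diagonals needs: a cell \<open>t\<close> of the
  last diagonal is matched with \<open>t\<close> or \<open>t - 1\<close>.\<close>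

locale layer =
  fixes g :: "nat set \<Rightarrow> nat set \<Rightarrow> real"
  assumes cover: "\<And>U T t. finite U \<Longrightarrow> finite T \<Longrightarrow> t \<in> T \<Longrightarrow> g U T =
      (if t \<in> U then g (U - {t}) (T - {t}) else 0) +
      (if t \<ge> 1 \<and> t - 1 \<in> U then g (U - {t - 1}) (T - {t}) else 0)"
begin

text \<open>The particles that end at \<open>u\<close> have still to be traced back, those below them came from \<open>s\<close>,
  and the lowest particle of \<open>u\<close> is treated next. The row of \<open>(1 + z) F\<close> at \<open>t\<close> is the sum of the rows of \<open>F\<close> at \<open>t\<close> and \<open>t - 1\<close>, which
  are the two possible sources of \<open>t\<close>. If \<open>t - 1\<close> is already taken, the corresponding
  determinant has a repeated row, so it vanishes as it should.\<close>

lemma vertical_strip_partial: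
  fixes u s :: "nat list"
  assumes "\<And>s. sorted_wrt (<) s \<Longrightarrow> set s \<subseteq> {..<a} \<Longrightarrow> length s = k \<Longrightarrow>
      g ({..<a} - set s) {} = coeff_minor F s"
  assumes "sorted_wrt (<) u" "set u \<subseteq> {..<a}" "length s + length u = k"
    and "sorted_wrt (<) s" "\<And>x y. x \<in> set s \<Longrightarrow> y \<in> set u \<Longrightarrow> x < y" "set s \<subseteq> {..<a}"
  shows "g ({..<a} - set s) (set u) =
      list_det (map (coeff_row F) s @ map (coeff_row (\<lambda>j. (1 + fps_X) * F j)) u)"
  using assms(2-)
proof (induction u arbitrary: s)
  case Nil
  then show ?case using assms(1)[of s] by (simp add: coeff_minor_def)
next
  case (Cons t u)
  let ?r = "coeff_row F" and ?r' = "coeff_row (\<lambda>j. (1 + fps_X) * F j)"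
  have t: "t < a" "t \<notin> set s" "t \<notin> set u"
    using Cons.prems by fastforce+
  have diff: "{..<a} - set s - {x} = {..<a} - set (s @ [x])" for x
    by auto
  have stay: "g ({..<a} - set s - {t}) (set u) = list_det (map ?r s @ ?r t # map ?r' u)"
    unfolding diff using Cons.IH[of "s @ [t]"] Cons.prems by (fastforce simp: sorted_wrt_append)
  have layer: "g ({..<a} - set s) (set (t # u)) = g ({..<a} - set s - {t}) (set u) +
      (if t \<ge> 1 \<and> t - 1 \<in> {..<a} - set s then g ({..<a} - set s - {t - 1}) (set u) else 0)"
    using t by (subst cover[of _ _ t]) auto
  show ?case
  proof (cases t)
    case 0
    have "?r' t = ?r t"
      by (auto simp: coeff_row_def distrib_right 0)
    then show ?thesis using stay layer 0 by simp
  next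
    case (Suc t')
    have split: "list_det (map ?r s @ map ?r' (t # u)) =
        list_det (map ?r s @ ?r t # map ?r' u) + list_det (map ?r s @ ?r t' # map ?r' u)"
      unfolding list.map by (rule list_det_add_row) (simp add: coeff_row_def distrib_right Suc)
    show ?thesis
    proof (cases "t' \<in> set s")
      case True
      then obtain s1 s2 where "s = s1 @ t' # s2" by (auto simp: in_set_conv_decomp)
      then have "list_det (map ?r s @ ?r t' # map ?r' u) = 0"
        using list_det_repeated_row[of "map ?r s1" "?r t'" "map ?r s2"] by simp
      then show ?thesis using stay layer split True Suc by simp
    next
      case False
      have less: "x < t'" if "x \<in> set s" for x
        using Cons.prems(5)[of x t] that False Suc by (cases "x = t'") auto
      have "g ({..<a} - set s - {t'}) (set u) = list_det (map ?r s @ ?r t' # map ?r' u)"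
        unfolding diff using Cons.IH[of "s @ [t']"] Cons.prems less Suc
        by (fastforce simp: sorted_wrt_append)
      then show ?thesis using stay layer split False Suc t by simp
    qed
  qed
qed

lemma vertical_strip_step:
  fixes u :: "nat list"
  assumes "\<And>s. sorted_wrt (<) s \<Longrightarrow> set s \<subseteq> {..<a} \<Longrightarrow> length s = k \<Longrightarrow>
      g ({..<a} - set s) {} = coeff_minor F s"
    and "sorted_wrt (<) u" "set u \<subseteq> {..<a}" "length u = k"
  shows "g {..<a} (set u) = coeff_minor (\<lambda>j. (1 + fps_X) * F j) u"
  using vertical_strip_partial[OF assms(1) assms(2,3), where s = "[]"] assms(4) by (simp add: coeff_minor_def)

end

text \<open>With the minus sign, the old columns of row \<open>x\<close> minus those of row \<open>x + 1\<close> give the row of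
  \<open>F\<close> at \<open>x\<close>, and the new column \<open>1 / (1 - z)\<close>, constantly 1, contributes 0.\<close>

definition horizontal :: "nat \<Rightarrow> (nat \<Rightarrow> real fps) \<Rightarrow> nat \<Rightarrow> real fps" where
  "horizontal k F j = (if j < k then - fps_X * F j else 1) * geometric"

lemma inverse_one_minus_X: "geometric = Abs_fps (\<lambda>_. 1)"
proof (rule fps_inverse_unique)
  show "(1 - fps_X :: real fps) * Abs_fps (\<lambda>_. 1) = 1"
  proof (rule fps_ext)
    fix m
    show "fps_nth ((1 - fps_X :: real fps) * Abs_fps (\<lambda>_. 1)) m = fps_nth 1 m"
      by (cases m) (simp_all add: left_diff_distrib)
  qed
qed

lemma coeff_row_horizontal_diff:
  "j < k \<Longrightarrow> coeff_row (horizontal k F) x j - coeff_row (horizontal k F) (Suc x) j = coeff_row F x j"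
  "coeff_row (horizontal k F) x k - coeff_row (horizontal k F) (Suc x) k = 0"
proof -
  have "horizontal k F j * (1 - fps_X) = (if j < k then - fps_X * F j else 1)" for j
    unfolding horizontal_def by (simp add: mult.assoc inverse_mult_eq_1)
  then have "fps_nth (horizontal k F j * (1 - fps_X)) (Suc x) =
      fps_nth (if j < k then - fps_X * F j else 1) (Suc x)" for j by simp
  from this[of j] this[of k]
  show "j < k \<Longrightarrow> coeff_row (horizontal k F) x j - coeff_row (horizontal k F) (Suc x) j = coeff_row F x j"
    "coeff_row (horizontal k F) x k - coeff_row (horizontal k F) (Suc x) k = 0"
    by (auto simp: coeff_row_def right_diff_distrib)
qed

lemma coeff_row_horizontal_last: "coeff_row (horizontal k F) x k = 1"
  by (simp add: coeff_row_def horizontal_def inverse_one_minus_X)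

context layer
begin

text \<open>Now the cells outside \<open>p\<close> are matched backwards, and the cells left over on the smaller diagonal
  are the old particles. Let \<open>R x\<close> be the rows of the new matrix and \<open>r x = R x - R (x + 1)\<close>, which
  is essentially the row \<open>x\<close> of \<open>F\<close>. The cells are matched in increasing order, and there are two
  kinds of intermediate states. All cells below \<open>x\<close> on the new diagonal have been dealt with, and
  \<open>s\<close> consists of the old particles found so far. In a closed state no cell of the old diagonal
  next to \<open>x\<close> is pending, and the count is the determinant with rows \<open>r s, R p\<close>, where \<open>p\<close> are
  the new particles to come. In an open state at \<open>y\<close>, the cell \<open>y\<close> of the old diagonal is still
  free although cell \<open>y\<close> of the new diagonal has been dealt with; the count is the determinant with rows
  \<open>r s, R y, R p\<close>. The identity \<open>R y = r y + R (y + 1)\<close> says that either \<open>y\<close> remains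
  free for good, and is thus an old particle, or it is used by \<open>y + 1\<close> and the state is open
  at \<open>y + 1\<close>. A new particle turns a closed state into an open one. Impossible ends correspond to
  determinants that vanish because of the last column.\<close>

lemma horizontal_strip_step:
  fixes p :: "nat list"
  assumes base: "\<And>s. sorted_wrt (<) s \<Longrightarrow> set s \<subseteq> {..<a} \<Longrightarrow> length s = k \<Longrightarrow>
      g (set s) {} = coeff_minor F s"
    and "sorted_wrt (<) p" "set p \<subseteq> {..a}" "length p = Suc k"
  shows "g {..<a} ({..a} - set p) = coeff_minor (horizontal k F) p"
proof -
  let ?R = "coeff_row (horizontal k F)"
  let ?r = "\<lambda>x j. ?R x j - ?R (Suc x) j"
  have r_last: "?r x k = 0" for x
    by (rule coeff_row_horizontal_diff(2))
  define open_at where "open_at y \<longleftrightarrow> (\<forall>s p. sorted_wrt (<) s \<and> (\<forall>z\<in>set s. z < y) \<and>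
      sorted_wrt (<) p \<and> (\<forall>z\<in>set p. y < z \<and> z \<le> a) \<and> length s + length p = k \<longrightarrow>
      g (set s \<union> {y..<a}) ({y<..a} - set p) = list_det (map ?r s @ ?R y # map ?R p))" for y
  define closed_at where "closed_at x \<longleftrightarrow> (\<forall>s p. sorted_wrt (<) s \<and> (\<forall>z\<in>set s. Suc z < x) \<and>
      sorted_wrt (<) p \<and> (\<forall>z\<in>set p. x \<le> z \<and> z \<le> a) \<and> length s + length p = Suc k \<longrightarrow>
      g (set s \<union> {x..<a}) ({x..a} - set p) = list_det (map ?r s @ map ?R p))" for x
  have split: "list_det (map ?r s @ ?R y # map ?R p) = list_det (map ?r s @ ?r y # map ?R p) +
      list_det (map ?r s @ ?R (Suc y) # map ?R p)" for s p y
    by (rule list_det_add_row) simp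
  have singular: "list_det (map ?r s) = 0" if "length s = Suc k" for s
    by (rule list_det_zero_column[of _ k]) (use that in \<open>auto simp: r_last\<close>)
  have "open_at x \<and> closed_at x" if "x \<le> a" for x
    using that
  proof (induction "a - x" arbitrary: x rule: less_induct)
    case less
    have IH: "open_at x'" "closed_at x'" if "x < x'" "x' \<le> a" for x'
      using less(1)[of x'] that by auto
    have opn: "open_at x"
      unfolding open_at_def
    proof (intro allI impI, elim conjE)
      fix s p :: "nat list"
      assume s: "sorted_wrt (<) s" "\<forall>z\<in>set s. z < x" and p: "sorted_wrt (<) p" "\<forall>z\<in>set p. x < z \<and> z \<le> a"
        and len: "length s + length p = k"
      consider "x = a" | "x < a" "Suc x \<in> set p" | "x < a" "Suc x \<notin> set p"
        using less.prems by linarith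
      then show "g (set s \<union> {x..<a}) ({x<..a} - set p) = list_det (map ?r s @ ?R x # map ?R p)"
      proof cases
        case 1
        then have [simp]: "p = []" using p(2) by (cases p) auto
        have "list_det (map ?r s @ [?R x]) = list_det (map ?r s)"
          using len by (intro list_det_unit_corner) (auto simp: r_last coeff_row_horizontal_last)
        also have "\<dots> = coeff_minor F s"
          unfolding coeff_minor_def using len
          by (intro list_det_cong) (auto simp: coeff_row_horizontal_diff(1))
        finally show ?thesis
          using base[of s] s len 1 by auto
      next
        case 2
        then obtain p' where p': "p = Suc x # p'"
          using p by (cases p) fastforce+
        have "list_det (map ?r s @ ?R (Suc x) # map ?R p) = 0"
          using list_det_repeated_row[of "map ?r s" "?R (Suc x)" "[]"] by (simp add: p')
        moreover have "g (set (s @ [x]) \<union> {Suc x..<a}) ({Suc x<..a} - set p') =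
            list_det (map ?r (s @ [x]) @ ?R (Suc x) # map ?R p')"
          using IH(1)[of "Suc x", unfolded open_at_def, rule_format, of "s @ [x]" p'] 2 s p len p'
          by (auto simp: sorted_wrt_append less_Suc_eq)
        moreover have "set (s @ [x]) \<union> {Suc x..<a} = set s \<union> {x..<a}" using 2 by auto
        moreover have "{Suc x<..a} - set p' = {x<..a} - set p" using p' by auto
        ultimately show ?thesis using split[of s x p] p' by simp
      next
        case 3
        have p_gt: "\<forall>z\<in>set p. Suc x < z \<and> z \<le> a"
          using p 3 by (metis Suc_lessI)
        have notin: "x \<notin> set s" "Suc x \<notin> set s" using s by auto
        have use_left: "g (set s \<union> {x..<a} - {x}) ({x<..a} - set p - {Suc x}) =
            list_det (map ?r s @ ?R (Suc x) # map ?R p)"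
        proof -
          have "set s \<union> {x..<a} - {x} = set s \<union> {Suc x..<a}"
            "{x<..a} - set p - {Suc x} = {Suc x<..a} - set p"
            using notin by auto
          then show ?thesis
            using IH(1)[of "Suc x", unfolded open_at_def, rule_format, of s p] 3 s p p_gt len
            by (auto simp: less_Suc_eq)
        qed
        \<comment> \<open>The cell \<open>a\<close> is missing on the old diagonal, so the last new cell can only go left.\<close>
        have use_right: "(if Suc x < a then g (set s \<union> {x..<a} - {Suc x}) ({x<..a} - set p - {Suc x})
            else 0) = list_det (map ?r s @ ?r x # map ?R p)"
        proof (cases "Suc x < a")
          case True
          have "set s \<union> {x..<a} - {Suc x} = set (s @ [x]) \<union> {Suc (Suc x)..<a}"
            "{x<..a} - set p - {Suc x} = {Suc (Suc x)..a} - set p"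
            using notin True by auto
          moreover have "g (set (s @ [x]) \<union> {Suc (Suc x)..<a}) ({Suc (Suc x)..a} - set p) =
              list_det (map ?r (s @ [x]) @ map ?R p)"
            using IH(2)[of "Suc (Suc x)", unfolded closed_at_def, rule_format, of "s @ [x]" p]
              True s p p_gt len
            by (fastforce simp: sorted_wrt_append Suc_le_eq)
          ultimately show ?thesis using True by simp
        next
          case False
          then have "p = []" using p_gt 3 by (cases p) auto
          then show ?thesis using False singular[of "s @ [x]"] len by simp
        qed
        have "g (set s \<union> {x..<a}) ({x<..a} - set p) =
          (if Suc x < a then g (set s \<union> {x..<a} - {Suc x}) ({x<..a} - set p - {Suc x}) else 0) +
          g (set s \<union> {x..<a} - {x}) ({x<..a} - set p - {Suc x})"
          using 3 notin by (subst cover[of _ _ "Suc x"]) auto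
        then show ?thesis using use_left use_right split[of s x p] by simp
      qed
    qed
    have "closed_at x"
      unfolding closed_at_def
    proof (intro allI impI, elim conjE)
      fix s p :: "nat list"
      assume s: "sorted_wrt (<) s" "\<forall>z\<in>set s. Suc z < x" and p: "sorted_wrt (<) p" "\<forall>z\<in>set p. x \<le> z \<and> z \<le> a"
        and len: "length s + length p = Suc k"
      show "g (set s \<union> {x..<a}) ({x..a} - set p) = list_det (map ?r s @ map ?R p)"
      proof (cases "x \<in> set p")
        case True
        then obtain p' where p': "p = x # p'"
          using p by (cases p) auto
        have "{x..a} - set p = {x<..a} - set p'" using p p' by auto
        moreover have "\<forall>z\<in>set s. z < x" using s by auto
        ultimately show ?thesis
          using opn[unfolded open_at_def, rule_format, of s p'] s p len p' by auto
      next
        case False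
        have p_gt: "\<forall>z\<in>set p. x < z \<and> z \<le> a"
          using p False by (metis le_neq_implies_less)
        have notin: "x \<notin> set s" "x - 1 \<notin> set s \<union> {x..<a} \<or> x = 0" using s by auto
        \<comment> \<open>The cell \<open>x - 1\<close> is taken, so \<open>x\<close> can only be matched with \<open>x\<close>.\<close>
        have *: "g (set s \<union> {x..<a}) ({x..a} - set p) =
            (if x < a then g (set s \<union> {x..<a} - {x}) ({x..a} - set p - {x}) else 0)"
          using False notin less.prems by (subst cover[of _ _ x]) auto
        show ?thesis
        proof (cases "x < a")
          case True
          have "set s \<union> {x..<a} - {x} = set s \<union> {Suc x..<a}"
            "{x..a} - set p - {x} = {Suc x..a} - set p"
            using notin by auto
          moreover have "g (set s \<union> {Suc x..<a}) ({Suc x..a} - set p) = list_det (map ?r s @ map ?R p)"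
            using IH(2)[of "Suc x", unfolded closed_at_def, rule_format, of s p] True s p p_gt len
            by (auto simp: Suc_le_eq less_Suc_eq)
          ultimately show ?thesis using * True by simp
        next
          case nlt: False
          then have "p = []" using p_gt less.prems by (cases p) auto
          then show ?thesis using * nlt singular[of s] len by simp
        qed
      qed
    qed
    with opn show ?case by blast
  qed
  from this[of 0] have "closed_at 0" by simp
  then have "g (set [] \<union> {0..<a}) ({0..a} - set p) = list_det (map ?r [] @ map ?R p)"
    using assms(2-4) by (auto simp: closed_at_def subset_iff dest!: spec[of _ "[]"])
  then show ?thesis
    by (simp add: coeff_minor_def atLeast0LessThan atLeast0AtMost)
qed

end

section \<open>Even and odd parts\<close>

definition even_part :: "real fps \<Rightarrow> real fps" where
  "even_part F = Abs_fps (\<lambda>i. fps_nth F (2 * i))"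

definition odd_part :: "real fps \<Rightarrow> real fps" where
  "odd_part F = Abs_fps (\<lambda>i. fps_nth F (2 * i + 1))"

text \<open>Substitution of \<open>z\<^sup>2\<close> for \<open>z\<close>; even and odd parts are linear over the series of this form.\<close>

definition dilate :: "real fps \<Rightarrow> real fps" where
  "dilate A = A oo fps_X\<^sup>2"

lemma dilate_nth: "fps_nth (dilate A) m = (if even m then fps_nth A (m div 2) else 0)"
proof -
  have "fps_nth (dilate A) m = (\<Sum>i=0..m. if m = 2 * i then fps_nth A i else 0)"
    unfolding dilate_def fps_compose_nth
    by (intro sum.cong) (auto simp: fps_X_power_nth simp flip: power_mult)
  also have "\<dots> = (if even m then fps_nth A (m div 2) else 0)"
  proof (cases "even m")
    case True
    then have "m = 2 * i \<longleftrightarrow> i = m div 2" for i by auto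
    then have "(\<Sum>i=0..m. if m = 2 * i then fps_nth A i else 0) =
        (\<Sum>i=0..m. if i = m div 2 then fps_nth A i else 0)" by simp
    then show ?thesis using True by simp
  next
    case False
    then show ?thesis by (auto intro!: sum.neutral)
  qed
  finally show ?thesis .
qed

lemma dilate_mult: "dilate (A * B) = dilate A * dilate B"
  unfolding dilate_def by (rule fps_compose_mult_distrib) simp

lemma dilate_diff: "dilate (A - B) = dilate A - dilate B"
  unfolding dilate_def by (rule fps_compose_sub_distrib)

lemma dilate_minus: "dilate (- A) = - dilate A"
  unfolding dilate_def by (rule fps_compose_uminus)

lemma dilate_X: "dilate fps_X = fps_X\<^sup>2"
  by (simp add: dilate_def)

lemma dilate_1: "dilate 1 = 1"
  by (simp add: dilate_def)

lemma parts_of_sum: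
  "even_part (dilate A + fps_X * dilate B) = A" "odd_part (dilate A + fps_X * dilate B) = B"
  by (rule fps_ext; auto simp: even_part_def odd_part_def dilate_nth)+

lemma sum_of_parts: "dilate (even_part F) + fps_X * dilate (odd_part F) = F"
proof (rule fps_ext)
  fix m show "fps_nth (dilate (even_part F) + fps_X * dilate (odd_part F)) m = fps_nth F m"
    by (cases m) (auto simp: even_part_def odd_part_def dilate_nth elim!: evenE oddE)
qed

lemma parts_dilate_mult:
  "even_part (dilate A * F) = A * even_part F" "odd_part (dilate A * F) = A * odd_part F"
proof -
  have "dilate A * F = dilate (A * even_part F) + fps_X * dilate (A * odd_part F)"
    by (subst sum_of_parts[of F, symmetric]) (simp add: dilate_mult algebra_simps)
  then show "even_part (dilate A * F) = A * even_part F" "odd_part (dilate A * F) = A * odd_part F"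
    by (simp_all only: parts_of_sum)
qed

lemma parts_add:
  "even_part (F + G) = even_part F + even_part G" "odd_part (F + G) = odd_part F + odd_part G"
  by (rule fps_ext; simp add: even_part_def odd_part_def)+

lemma geometric: "(1 - fps_X) * geometric = 1"
  by (simp add: inverse_mult_eq_1')

text \<open>The factor picked up by a column during one horizontal and one vertical step.\<close>

definition step_series :: "real fps" where
  "step_series = - fps_X * (1 + fps_X) * geometric"

lemma dilate_geometric: "(1 - fps_X\<^sup>2) * dilate geometric = 1"
  using arg_cong[OF geometric, of dilate] by (simp add: dilate_mult dilate_diff dilate_1 dilate_X)

text \<open>With \<open>z\<^sup>2\<close> in place of the variable, this is \<open>w(z) + w(-z)\<close> for \<open>w = step_series\<close>.\<close>

definition trace_series :: "real fps" where
  "trace_series = - 4 * fps_X * geometric"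

text \<open>The Lucas sequence of the quadratic equation \<open>w\<^sup>2 = - 4 t / (1 - t) w + t\<close>.\<close>

fun lucas :: "nat \<Rightarrow> real fps" where
  "lucas 0 = 1"
| "lucas (Suc 0) = trace_series"
| "lucas (Suc (Suc j)) = trace_series * lucas (Suc j) + fps_X * lucas j"

lemma unit_fps_cancel:
  fixes A :: "real fps"
  assumes "A * F = A * G" "fps_nth A 0 \<noteq> 0"
  shows "F = G"
  using assms by (metis fps_zero_nth mult_cancel_left)

lemma geometric_dilate: "geometric = (1 + fps_X) * dilate geometric"
proof (rule unit_fps_cancel)
  have "(1 - fps_X) * ((1 + fps_X) * dilate geometric) = (1 - fps_X\<^sup>2) * dilate geometric"
    by (simp add: algebra_simps power2_eq_square)
  then show "(1 - fps_X) * geometric = (1 - fps_X) * ((1 + fps_X) * dilate geometric)"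
    by (simp only: geometric dilate_geometric)
qed simp

lemma dilate_trace_series: "dilate trace_series = - 4 * fps_X\<^sup>2 * dilate geometric"
proof -
  have "dilate 4 = 4"
    by (rule fps_ext) (auto simp: dilate_nth fps_numeral_nth elim!: evenE)
  then show ?thesis by (simp add: trace_series_def dilate_mult dilate_minus dilate_X)
qed

lemma step_series_dilate: "step_series = - fps_X * (1 + fps_X)\<^sup>2 * dilate geometric"
  unfolding step_series_def by (subst geometric_dilate) (simp add: power2_eq_square mult.assoc)

text \<open>After replacing \<open>1 / (1 - z)\<close> by \<open>(1 + z) / (1 - z\<^sup>2)\<close>, this becomes the polynomial identity
  \<open>(1 + z)\<^sup>2 = 4 z + (1 - z)\<^sup>2\<close>.\<close>

lemma step_series_quadratic:
  "step_series ^ Suc (Suc j) = dilate trace_series * step_series ^ Suc j + dilate fps_X * step_series ^ j"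
proof -
  define h where "h = dilate geometric"
  have h: "(1 - fps_X\<^sup>2) * h = 1" unfolding h_def by (rule dilate_geometric)
  have "step_series\<^sup>2 = fps_X\<^sup>2 * (1 + fps_X) ^ 4 * h\<^sup>2"
    unfolding step_series_dilate h_def[symmetric] by (simp add: algebra_simps eval_nat_numeral)
  also have "\<dots> = (- 4 * fps_X\<^sup>2 * h) * (- fps_X * (1 + fps_X)\<^sup>2 * h) +
      fps_X\<^sup>2 * ((1 - fps_X\<^sup>2) * h)\<^sup>2"
    by (simp add: algebra_simps eval_nat_numeral)
  also have "\<dots> = dilate trace_series * step_series + dilate fps_X"
    unfolding h dilate_trace_series dilate_X step_series_dilate h_def[symmetric] by simp
  finally have "step_series\<^sup>2 * step_series ^ j =
      (dilate trace_series * step_series + dilate fps_X) * step_series ^ j" by simp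
  then show ?thesis
    by (simp add: algebra_simps power2_eq_square)
qed

lemma parts_X_mult:
  "even_part (fps_X * F) = fps_X * odd_part F" "odd_part (fps_X * F) = even_part F"
proof -
  have "fps_nth (even_part (fps_X * F)) i = fps_nth (fps_X * odd_part F) i" for i
    by (cases i) (simp_all add: even_part_def odd_part_def)
  then show "even_part (fps_X * F) = fps_X * odd_part F" by (rule fps_ext)
  show "odd_part (fps_X * F) = even_part F"
    by (rule fps_ext) (simp add: even_part_def odd_part_def)
qed

lemma parts_minus: "even_part (- F) = - even_part F" "odd_part (- F) = - odd_part F"
  by (rule fps_ext; simp add: even_part_def odd_part_def)+

lemma parts_1: "even_part 1 = 1" "odd_part 1 = 0"
  by (rule fps_ext; simp add: even_part_def odd_part_def)+

lemma parts_geometric_mult: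
  "even_part (geometric * F) = geometric * (even_part F + fps_X * odd_part F)"
  "odd_part (geometric * F) = geometric * (even_part F + odd_part F)"
proof -
  have "geometric * F = dilate geometric * (F + fps_X * F)"
    by (subst geometric_dilate) (simp add: algebra_simps)
  then show "even_part (geometric * F) = geometric * (even_part F + fps_X * odd_part F)"
    "odd_part (geometric * F) = geometric * (even_part F + odd_part F)"
    by (simp_all only: parts_dilate_mult parts_add parts_X_mult add.commute)
qed

lemma parts_one_plus_X_mult:
  "even_part ((1 + fps_X) * F) = even_part F + fps_X * odd_part F"
  "odd_part ((1 + fps_X) * F) = even_part F + odd_part F"
  by (simp_all add: distrib_right parts_add parts_X_mult)

lemmas parts_simps = parts_X_mult parts_minus parts_1 parts_geometric_mult parts_one_plus_X_mult

text \<open>This form lets the rules \<open>parts_simps\<close> compute the parts factor by factor.\<close>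

lemma step_series_nested: "step_series = - (fps_X * ((1 + fps_X) * (geometric * 1)))"
  by (simp add: step_series_def mult.assoc)

lemma even_part_step_series:
  "even_part ((1 + fps_X) * geometric * step_series ^ j) = (1 + fps_X) * geometric * lucas j"
proof (induction j rule: lucas.induct)
  case 1
  have "even_part ((1 + fps_X) * (geometric * 1)) = (1 + fps_X) * geometric"
    unfolding parts_simps by (simp add: algebra_simps eval_nat_numeral)
  then show ?case by simp
next
  case 2
  have "even_part ((1 + fps_X) * (geometric * step_series)) = (1 + fps_X) * geometric * trace_series"
    unfolding step_series_nested parts_simps trace_series_def by (simp add: algebra_simps eval_nat_numeral)
  then show ?case by (simp add: mult.assoc)
next
  case (3 j)
  have "(1 + fps_X) * geometric * step_series ^ Suc (Suc j) =
    dilate trace_series * ((1 + fps_X) * geometric * step_series ^ Suc j) +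
    dilate fps_X * ((1 + fps_X) * geometric * step_series ^ j)"
    unfolding step_series_quadratic by (simp only: algebra_simps)
  then show ?case
    by (simp only: parts_add parts_dilate_mult 3 lucas.simps) (simp only: algebra_simps)
qed

lemma odd_part_step_series:
  "odd_part (geometric * step_series ^ j) =
    geometric * (lucas j - (if j = 0 then 0 else lucas (j - 1)))"
proof (induction j rule: lucas.induct)
  case 1
  have "odd_part (geometric * 1) = geometric"
    unfolding parts_simps by (simp add: algebra_simps eval_nat_numeral)
  then show ?case by simp
next
  case 2
  have "odd_part (geometric * step_series) = geometric * (trace_series - (1 - fps_X) * geometric)"
    unfolding step_series_nested parts_simps trace_series_def by (simp add: algebra_simps eval_nat_numeral)
  then show ?case unfolding geometric by simp
next
  case (3 j)
  have "geometric * step_series ^ Suc (Suc j) =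
    dilate trace_series * (geometric * step_series ^ Suc j) +
    dilate fps_X * (geometric * step_series ^ j)"
    unfolding step_series_quadratic by (simp only: algebra_simps)
  then have "odd_part (geometric * step_series ^ Suc (Suc j)) =
    trace_series * (geometric * (lucas (Suc j) - lucas j)) +
    fps_X * (geometric * (lucas j - (if j = 0 then 0 else lucas (j - 1))))"
    by (simp only: parts_add parts_dilate_mult 3) simp
  then show ?case
    by (cases j) (simp_all add: algebra_simps)
qed

text \<open>Multiplication by \<open>A\<close> acts on coefficient sequences by a lower triangular Toeplitz matrix with
  unit diagonal.\<close>

lemma coeff_matrix_det_mult_fps:
  fixes F :: "nat \<Rightarrow> real fps"
  assumes "fps_nth A 0 = 1"
  shows "Determinant.det (Matrix.mat n n (\<lambda>(i, j). fps_nth (A * F j) i)) =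
    Determinant.det (Matrix.mat n n (\<lambda>(i, j). fps_nth (F j) i))"
proof -
  let ?M = "Matrix.mat n n (\<lambda>(i, j). fps_nth (F j) i)"
  let ?L = "Matrix.mat n n (\<lambda>(i, k). if k \<le> i then fps_nth A (i - k) else 0)"
  have "Matrix.mat n n (\<lambda>(i, j). fps_nth (A * F j) i) = ?L * ?M"
  proof (intro eq_matI)
    fix i j assume "i < dim_row (?L * ?M)" "j < dim_col (?L * ?M)"
    then have ij: "i < n" "j < n" by auto
    have "(?L * ?M) $$ (i, j) =
        (\<Sum>k=0..<n. (if k \<le> i then fps_nth A (i - k) else 0) * fps_nth (F j) k)"
      using ij by (simp add: scalar_prod_def)
    also have "\<dots> = (\<Sum>k=0..i. fps_nth (F j) k * fps_nth A (i - k))"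
      using ij by (intro sum.mono_neutral_cong_right) auto
    also have "\<dots> = fps_nth (A * F j) i"
      by (simp only: mult.commute[of A] fps_mult_nth)
    finally show "Matrix.mat n n (\<lambda>(i, j). fps_nth (A * F j) i) $$ (i, j) = (?L * ?M) $$ (i, j)"
      using ij by simp
  qed simp_all
  moreover have "diag_mat ?L = replicate n 1"
    by (intro nth_equalityI) (auto simp: assms diag_mat_def)
  then have "Determinant.det ?L = 1"
    by (subst Determinant.det_lower_triangular[where n = n]) auto
  ultimately show ?thesis
    by (simp add: Determinant.det_mult[where n = n])
qed

lemma det_subtract_next_column:
  fixes U :: "nat \<Rightarrow> nat \<Rightarrow> real"
  assumes "\<And>i j. V i j = U i j - (if Suc j < n then U i (Suc j) else 0)"
  shows "Determinant.det (Matrix.mat n n (\<lambda>(i, j). V i j)) =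
    Determinant.det (Matrix.mat n n (\<lambda>(i, j). U i j))"
proof -
  let ?M = "Matrix.mat n n (\<lambda>(i, j). U i j)"
  let ?C = "Matrix.mat n n (\<lambda>(k, j). if k = j then 1 else if k = Suc j then - 1 else 0 :: real)"
  have "Matrix.mat n n (\<lambda>(i, j). V i j) = ?M * ?C"
  proof (intro eq_matI)
    fix i j assume "i < dim_row (?M * ?C)" "j < dim_col (?M * ?C)"
    then have ij: "i < n" "j < n" by auto
    have "(?M * ?C) $$ (i, j) = (\<Sum>k=0..<n. U i k * (if k = j then 1 else if k = Suc j then - 1 else 0))"
      using ij by (simp add: scalar_prod_def)
    also have "\<dots> = (\<Sum>k=0..<n. (if k = j then U i k else 0) - (if k = Suc j then U i k else 0))"
      by (intro sum.cong) auto
    also have "\<dots> = V i j"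
      using ij by (simp add: sum_subtractf assms)
    finally show "Matrix.mat n n (\<lambda>(i, j). V i j) $$ (i, j) = (?M * ?C) $$ (i, j)"
      using ij by simp
  qed simp_all
  moreover have "diag_mat ?C = replicate n 1"
    by (intro nth_equalityI) (auto simp: diag_mat_def)
  then have "Determinant.det ?C = 1"
    by (subst Determinant.det_lower_triangular[where n = n]) auto
  ultimately show ?thesis
    by (simp add: Determinant.det_mult[where n = n])
qed

text \<open>In both cases the positions pick out a parity part of each series, and unitriangular row and
  column operations reduce the determinant to that of the Lucas sequence.\<close>

lemma even_minor_eq_odd_minor:
  "coeff_minor (\<lambda>j. geometric * step_series ^ (n - 1 - j)) (map (\<lambda>i. 2 * i + 1) [0..<n]) =
   coeff_minor (\<lambda>j. (1 + fps_X) * geometric * step_series ^ (n - 1 - j)) (map (\<lambda>i. 2 * i) [0..<n])"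
proof -
  let ?U = "\<lambda>i j. fps_nth (lucas (n - 1 - j)) i"
  let ?D = "\<lambda>V. Determinant.det (Matrix.mat n n (\<lambda>(i, j). V i j :: real))"
  have "coeff_minor (\<lambda>j. geometric * step_series ^ (n - 1 - j)) (map (\<lambda>i. 2 * i + 1) [0..<n]) =
    ?D (\<lambda>i j. fps_nth (odd_part (geometric * step_series ^ (n - 1 - j))) i)"
    unfolding coeff_minor_def list_det_def
    by (intro arg_cong[of _ _ Determinant.det] eq_matI) (auto simp: coeff_row_def odd_part_def)
  also have "\<dots> = ?D (\<lambda>i j. fps_nth (lucas (n - 1 - j) -
      (if n - 1 - j = 0 then 0 else lucas (n - 1 - j - 1))) i)"
    unfolding odd_part_step_series by (rule coeff_matrix_det_mult_fps) simp
  also have "\<dots> = ?D ?U"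
    by (rule det_subtract_next_column) auto
  also have "\<dots> = ?D (\<lambda>i j. fps_nth ((1 + fps_X) * geometric * lucas (n - 1 - j)) i)"
    by (rule coeff_matrix_det_mult_fps[symmetric]) simp
  also have "\<dots> = ?D (\<lambda>i j. fps_nth (even_part ((1 + fps_X) * geometric * step_series ^ (n - 1 - j))) i)"
    by (simp only: even_part_step_series)
  also have "\<dots> = coeff_minor (\<lambda>j. (1 + fps_X) * geometric * step_series ^ (n - 1 - j))
      (map (\<lambda>i. 2 * i) [0..<n])"
    unfolding coeff_minor_def list_det_def
    by (intro arg_cong[of _ _ Determinant.det] eq_matI) (auto simp: coeff_row_def even_part_def)
  finally show ?thesis .
qed

section \<open>Tilings counted by minors\<close>

interpretation two_layers: layer "\<lambda>U T. real (two_layers m D U T)" for m D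
proof
  fix U T :: "nat set" and t :: nat
  assume "finite U" "finite T" "t \<in> T"
  from two_layers_cover[OF this, of m D]
  show "real (two_layers m D U T) =
      (if t \<in> U then real (two_layers m D (U - {t}) (T - {t})) else 0) +
      (if t \<ge> 1 \<and> t - 1 \<in> U then real (two_layers m D (U - {t - 1}) (T - {t})) else 0)"
    by simp
qed

text \<open>The columns are ordered by the age of the particles: column \<open>j\<close> was created by the horizontal
  strip that leads to diagonal \<open>2j + 1\<close>, and has since been multiplied by \<open>step_series\<close> once
  for every later horizontal strip.\<close>

definition even_layer :: "nat \<Rightarrow> nat \<Rightarrow> bool" where
  "even_layer m k \<longleftrightarrow> (\<forall>u. sorted_wrt (<) u \<and> set u \<subseteq> {..<m + k} \<and> length u = k \<longrightarrow>
    two_layers m (2 * k) (set u) {} = coeff_minor (\<lambda>j. (1 + fps_X) * geometric * step_series ^ (k - 1 - j)) u)"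

definition odd_layer :: "nat \<Rightarrow> nat \<Rightarrow> bool" where
  "odd_layer m k \<longleftrightarrow> (\<forall>p. sorted_wrt (<) p \<and> set p \<subseteq> {..m + k} \<and> length p = Suc k \<longrightarrow>
    two_layers m (Suc (2 * k)) ({..m + k} - set p) {} = coeff_minor (\<lambda>j. geometric * step_series ^ (k - j)) p)"

lemma even_layer_0: "even_layer m 0"
  by (simp add: even_layer_def two_layers_def staircase_def matchings_empty coeff_minor_def list_det_def)

lemma odd_layer_from_even:
  assumes "even_layer m k"
  shows "odd_layer m k"
  unfolding odd_layer_def
proof (intro allI impI, elim conjE)
  fix p :: "nat list"
  assume p: "sorted_wrt (<) p" "set p \<subseteq> {..m + k}" "length p = Suc k"
  let ?F = "\<lambda>j. (1 + fps_X) * geometric * step_series ^ (k - 1 - j)"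
  have "real (two_layers m (2 * k) {..<m + k} ({..m + k} - set p)) = coeff_minor (horizontal k ?F) p"
    using assms p by (intro two_layers.horizontal_strip_step) (auto simp: even_layer_def)
  also have "\<dots> = coeff_minor (\<lambda>j. geometric * step_series ^ (k - j)) p"
  proof (rule coeff_minor_cong)
    fix j assume "j < length p"
    then consider "j = k" | i where "k - j = Suc i" "k - 1 - j = i" "j < k"
      using p(3) by (cases "k - j") auto
    then show "horizontal k ?F j = geometric * step_series ^ (k - j)"
      by cases (simp_all add: horizontal_def step_series_def algebra_simps)
  qed
  finally show "two_layers m (Suc (2 * k)) ({..m + k} - set p) {} =
      coeff_minor (\<lambda>j. geometric * step_series ^ (k - j)) p"
    using two_layers_full[of m "2 * k"] by simp
qed

lemma even_layer_from_odd:
  assumes "odd_layer m k"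
  shows "even_layer m (Suc k)"
  unfolding even_layer_def
proof (intro allI impI, elim conjE)
  fix u :: "nat list"
  assume u: "sorted_wrt (<) u" "set u \<subseteq> {..<m + Suc k}" "length u = Suc k"
  have "real (two_layers m (Suc (2 * k)) {..<m + Suc k} (set u)) =
      coeff_minor (\<lambda>j. (1 + fps_X) * (geometric * step_series ^ (k - j))) u"
    using assms u
    by (intro two_layers.vertical_strip_step) (auto simp: odd_layer_def lessThan_Suc_atMost)
  then show "two_layers m (2 * Suc k) (set u) {} =
      coeff_minor (\<lambda>j. (1 + fps_X) * geometric * step_series ^ (Suc k - 1 - j)) u"
    using two_layers_full[of m "Suc (2 * k)"] by (simp add: mult.assoc)
qed

lemma even_layer: "even_layer m k"
  by (induction k) (auto intro: even_layer_0 even_layer_from_odd odd_layer_from_even)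

lemma odd_layer: "odd_layer m k"
  by (intro odd_layer_from_even even_layer)

section \<open>The two triangles\<close>

lemma sorted_wrt_map_upt:
  assumes "\<And>i j. i < j \<Longrightarrow> f i < (f j :: nat)"
  shows "sorted_wrt (<) (map f [0..<n])"
  using assms by (simp add: sorted_wrt_map sorted_wrt_iff_nth_less)

text \<open>Both staircase partitions at once: \<open>a = 1\<close> gives \<open>(n, \<dots>, 1)\<close> and \<open>a = 0\<close> gives
  \<open>(n - 1, \<dots>, 0)\<close>.\<close>

lemma particles_rev_upt: "particles (rev [a..<a + n]) = (\<lambda>i. 2 * i + a) ` {0..<n}"
proof -
  have *: "rev [a..<a + n] ! (j - 1) + (n - j) = 2 * (n - j) + a" if "1 \<le> j" "j \<le> n" for j
    using that by (simp add: rev_nth)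
  show ?thesis
  proof (intro subset_antisym subsetI)
    fix x assume "x \<in> particles (rev [a..<a + n])"
    then obtain j where "1 \<le> j" "j \<le> n" "x = rev [a..<a + n] ! (j - 1) + (n - j)"
      by (auto simp: particles_def)
    with *[of j] show "x \<in> (\<lambda>i. 2 * i + a) ` {0..<n}" by auto
  next
    fix x assume "x \<in> (\<lambda>i. 2 * i + a) ` {0..<n}"
    then obtain i where "i < n" "x = 2 * i + a" by auto
    with *[of "n - i"] show "x \<in> particles (rev [a..<a + n])"
      unfolding particles_def by (auto intro!: exI[of _ "n - i"])
  qed
qed

lemma first_part_rev_upt: "n \<ge> 1 \<Longrightarrow> first_part (rev [a..<a + n]) = a + n - 1"
  by (cases n) (simp_all add: first_part_def)

lemma aztec_triangle_even:
  assumes "length \<mu> = n"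
  shows "aztec_triangle \<mu> (2 * n) =
    region (staircase (first_part \<mu>) (2 * n - 1) \<union> holes \<mu> \<times> {2 * n - 1})"
proof -
  have "d + 2 \<le> 2 * n \<longleftrightarrow> d < 2 * n - 1" for d by linarith
  then show ?thesis
    unfolding aztec_triangle_def region_def staircase_def using assms by (auto simp: Let_def)
qed

lemma aztec_triangle_odd:
  assumes "length \<mu> = n"
  shows "aztec_triangle \<mu> (2 * n + 1) =
    region (staircase (first_part \<mu>) (2 * n) \<union> particles \<mu> \<times> {2 * n})"
  unfolding aztec_triangle_def region_def staircase_def using assms
  by (auto simp: Let_def Suc_le_eq)

theorem theorem1p4:
  fixes n :: nat
  assumes "n \<ge> 1"
  shows "num_domino_tilings (aztec_triangle (rev [1..<n + 1]) (2 * n)) =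
         num_domino_tilings (aztec_triangle (rev [0..<n]) (2 * n + 1))"
proof -
  let ?odds = "map (\<lambda>i. 2 * i + 1) [0..<n]" and ?evens = "map (\<lambda>i. 2 * i) [0..<n]"
  have last_diagonal: "Suc (2 * (n - 1)) = 2 * n - 1"
    using assms by auto
  have evens_less: "set ?evens \<subseteq> {..<n - 1 + n}" by auto
  have odds_le: "set ?odds \<subseteq> {..n + (n - 1)}" by auto
  have holes: "holes (rev [1..<n + 1]) = {..n + (n - 1)} - set ?odds"
    using particles_rev_upt[of 1 n] first_part_rev_upt[OF assms, of 1] assms
    by (auto simp: holes_def add.commute)
  have "num_domino_tilings (aztec_triangle (rev [1..<n + 1]) (2 * n)) =
      two_layers n (Suc (2 * (n - 1))) ({..n + (n - 1)} - set ?odds) {}"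
    using aztec_triangle_even[of "rev [1..<n + 1]" n] first_part_rev_upt[OF assms, of 1]
    unfolding holes last_diagonal two_layers_def
    by (simp add: num_domino_tilings_region add.commute)
  also have "real \<dots> = coeff_minor (\<lambda>j. geometric * step_series ^ (n - 1 - j)) ?odds"
    by (rule odd_layer[of n "n - 1", unfolded odd_layer_def, rule_format])
      (use odds_le assms in \<open>simp add: sorted_wrt_map_upt del: set_map\<close>)
  finally have odds: "real (num_domino_tilings (aztec_triangle (rev [1..<n + 1]) (2 * n))) = \<dots>" .
  have "num_domino_tilings (aztec_triangle (rev [0..<n]) (2 * n + 1)) =
      two_layers (n - 1) (2 * n) (set ?evens) {}"
    using aztec_triangle_odd[of "rev [0..<n]" n] first_part_rev_upt[OF assms, of 0]
      particles_rev_upt[of 0 n]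
    unfolding two_layers_def by (simp add: num_domino_tilings_region)
  also have "real \<dots> = coeff_minor (\<lambda>j. (1 + fps_X) * geometric * step_series ^ (n - 1 - j)) ?evens"
    by (rule even_layer[of "n - 1" n, unfolded even_layer_def, rule_format])
      (use evens_less assms in \<open>simp add: sorted_wrt_map_upt del: set_map\<close>)
  finally have "real (num_domino_tilings (aztec_triangle (rev [0..<n]) (2 * n + 1))) = \<dots>" .
  with odds have "real (num_domino_tilings (aztec_triangle (rev [1..<n + 1]) (2 * n))) =
      real (num_domino_tilings (aztec_triangle (rev [0..<n]) (2 * n + 1)))"
    using even_minor_eq_odd_minor by (simp only:)
  then show ?thesis by (simp only: of_nat_eq_iff)
qed

end
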